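(* For every linear decaying stochastic depletion problem, for all states $s,s'\in\mathcal S$ such that $x(s)\ge x(s')$ (componentwise) and $t(s)=t(s')$, one has $J^*(s)\ge J^*(s')$.
   Context: Linear decaying stochastic depletion problem (clairvoyant form). There are $M$ item types, with at most $\bar x_m\in\mathbb Z_+$ items of type $m$; a finite nonempty set $\mathcal A$ of activities; a horizon $T$ (a positive integer); and, for each $A\in\mathcal A$, a fixed known sequence $P_t(A)=(P_{t,1}(A),\dots,P_{t,M}(A))\in[0,1]^M$, $t=0,1,2,\dots$. The state space is $\mathcal S=\{(x,t): x\in\prod_{m}\{0,\dots,\bar x_m\},\ t\in\{0,\dots,T\}\}$; for $s=(x,t)$ write $x(s)=x$, $t(s)=t$. If activity $A$ is used in state $s=(x,t)$ with $t<T$, a random vector $X_t=(X_{t,m})_m$ of items is depleted, where the $X_{t,m}$ are independent of each other and (given $x$ and $P_t(A)$) of the past, and $X_{t,m}\sim\mathrm{Binomial}(x_m,P_{t,m}(A))$. The next state is $(x-X_t,t+1)$ and the reward earned is $R(s,A)=\sum_m w_{m,t}X_{t,m}$, where for each $m$, $w_{m,t}$ is a non-negative, non-increasing function of $t\in\{0,\dots,T\}$. A policy is a map $\pi:\mathcal S\to\mathcal A$; $J^\pi(s)=E\big[\sum_{t'=t(s)}^{T-1}R(S_{t'},\pi(S_{t'}))\mid S_{t(s)}=s\big]$, where $S_t$ is the state at time $t$ under $\pi$, and $J^*(s)=\max_\pi J^\pi(s)$. *)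

theory Defs
  imports "HOL-Probability.Probability"
begin

text \<open>
  Item types form a finite type \<open>'m\<close>. The functions \<open>prob\<close> (arguments: activity, time, item type)
  and \<open>weight\<close> (arguments: item type, time) are total; only activities in \<open>activities\<close> and
  times up to \<open>horizon\<close> are relevant.
\<close>

record ('m, 'a) sdp =
  max_items :: "'m \<Rightarrow> nat"
  activities :: "'a set"
  horizon :: nat
  prob :: "'a \<Rightarrow> nat \<Rightarrow> 'm \<Rightarrow> real"
  weight :: "'m \<Rightarrow> nat \<Rightarrow> real"

definition linear_decaying_sdp :: "('m::finite, 'a) sdp \<Rightarrow> bool" where
  "linear_decaying_sdp D \<longleftrightarrow>
     finite (activities D) \<and> activities D \<noteq> {} \<and>
     horizon D > 0 \<and>
     (\<forall>A\<in>activities D. \<forall>t m. prob D A t m \<in> {0..1}) \<and>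
     (\<forall>m. (\<forall>t\<in>{0..horizon D}. weight D m t \<ge> 0) \<and> antimono_on {0..horizon D} (weight D m))"

type_synonym 'm state = "('m \<Rightarrow> nat) \<times> nat"

definition states :: "('m::finite, 'a) sdp \<Rightarrow> 'm state set" where
  "states D = {(x, t). (\<forall>m. x m \<le> max_items D m) \<and> t \<le> horizon D}"

definition depletion :: "('m::finite, 'a) sdp \<Rightarrow> 'm state \<Rightarrow> 'a \<Rightarrow> ('m \<Rightarrow> nat) pmf" where
  "depletion D s A = Pi_pmf UNIV 0 (\<lambda>m. binomial_pmf (fst s m) (prob D A (snd s) m))"

definition next_state :: "'m state \<Rightarrow> ('m \<Rightarrow> nat) \<Rightarrow> 'm state" where
  "next_state s X = (\<lambda>m. fst s m - X m, Suc (snd s))"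

definition reward :: "('m::finite, 'a) sdp \<Rightarrow> 'm state \<Rightarrow> ('m \<Rightarrow> nat) \<Rightarrow> real" where
  "reward D s X = (\<Sum>m\<in>UNIV. weight D m (snd s) * real (X m))"

text \<open>
  Joint law of the first \<open>n\<close> pairs (state, depleted items) of the process that starts in \<open>s\<close>
  and follows \<open>\<pi>\<close>.
\<close>

primrec trajectory ::
  "('m::finite, 'a) sdp \<Rightarrow> ('m state \<Rightarrow> 'a) \<Rightarrow> nat \<Rightarrow> 'm state \<Rightarrow> ('m state \<times> ('m \<Rightarrow> nat)) list pmf" where
  "trajectory D \<pi> 0 s = return_pmf []"
| "trajectory D \<pi> (Suc n) s =
     bind_pmf (depletion D s (\<pi> s)) (\<lambda>X.
       map_pmf (\<lambda>\<omega>. (s, X) # \<omega>) (trajectory D \<pi> n (next_state s X)))"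

text \<open>The pair at time \<open>t\<close> sits at list position \<open>t - snd s\<close>.\<close>

definition J :: "('m::finite, 'a) sdp \<Rightarrow> ('m state \<Rightarrow> 'a) \<Rightarrow> 'm state \<Rightarrow> real" where
  "J D \<pi> s =
     measure_pmf.expectation (trajectory D \<pi> (horizon D - snd s) s)
       (\<lambda>\<omega>. \<Sum>t\<in>{snd s..<horizon D}. case \<omega> ! (t - snd s) of (s', X) \<Rightarrow> reward D s' X)"

definition policies :: "('m::finite, 'a) sdp \<Rightarrow> ('m state \<Rightarrow> 'a) set" where
  "policies D = states D \<rightarrow>\<^sub>E activities D"

definition J_opt :: "('m::finite, 'a) sdp \<Rightarrow> 'm state \<Rightarrow> real" where
  "J_opt D s = Max ((\<lambda>\<pi>. J D \<pi> s) ` policies D)"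

lemma finite_states: "finite (states (D :: ('m::finite, 'a) sdp))"
proof -
  have "states D = (\<Pi>\<^sub>E m\<in>UNIV. {..max_items D m}) \<times> {..horizon D}"
    by (auto simp: states_def PiE_UNIV_domain)
  then show ?thesis
    by (simp add: finite_PiE)
qed

lemma finite_policies: "linear_decaying_sdp D \<Longrightarrow> finite (policies D)"
  by (auto simp: policies_def linear_decaying_sdp_def intro!: finite_PiE finite_states)

lemma policies_nonempty: "linear_decaying_sdp D \<Longrightarrow> policies D \<noteq> {}"
  by (auto simp: policies_def linear_decaying_sdp_def PiE_eq_empty_iff)

lemma J_opt_attained:
  assumes "linear_decaying_sdp D"
  obtains \<pi> where "\<pi> \<in> policies D" "J_opt D s = J D \<pi> s"
proof -
  have "J_opt D s \<in> (\<lambda>\<pi>. J D \<pi> s) ` policies D"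
    unfolding J_opt_def
    using finite_policies[OF assms] policies_nonempty[OF assms] by (intro Max_in) auto
  then show ?thesis using that by auto
qed

end

theory Submission
  imports Defs
begin

text \<open>
  The argument is dynamic programming with a coupling. Write the larger inventory as \<open>x + d\<close>, where
  \<open>x\<close> is the smaller one, and use the same activity in both. Since
  \<open>Binomial(x + d, p)\<close> is the law of the sum of independent \<open>Binomial(x, p)\<close> and \<open>Binomial(d, p)\<close>
  variables, the depletion from \<open>x + d\<close> has the law of \<open>X + Y\<close>, with \<open>X\<close> the depletion from
  \<open>x\<close> and \<open>Y\<close> an independent depletion from the surplus \<open>d\<close>. The larger inventory then earns at least
  as much in this step, because weights are non-negative, and is still at least the other
  one after it, because \<open>Y \<le> d\<close>. Induction on the number of remaining steps shows that the solution of the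
  Bellman recursion is monotone in the inventory (\<open>bellman_value_mono\<close>).

  It remains to identify \<open>J_opt\<close> with that solution (\<open>J_opt_eq_bellman_value\<close>). The expected
  reward of a fixed policy satisfies the one-step recursion \<open>policy_value_Suc\<close>;
  hence no policy exceeds the Bellman value, and one that attains
  the Bellman maximum in every state achieves it.
\<close>

section \<open>Depletion laws\<close>

lemma expectation_bind_pmf_finite:
  fixes h :: "'b \<Rightarrow> real"
  assumes "finite (set_pmf p)" "\<And>x. x \<in> set_pmf p \<Longrightarrow> finite (set_pmf (f x))"
  shows "measure_pmf.expectation (bind_pmf p f) h =
         measure_pmf.expectation p (\<lambda>x. measure_pmf.expectation (f x) h)"
  using assms by (simp add: pmf_expectation_bind[of "set_pmf p"] integral_measure_pmf[of "set_pmf p"])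

lemma expectation_mono_finite:
  fixes f g :: "'b \<Rightarrow> real"
  assumes "finite (set_pmf p)" "\<And>x. x \<in> set_pmf p \<Longrightarrow> f x \<le> g x"
  shows "measure_pmf.expectation p f \<le> measure_pmf.expectation p g"
  using assms by (intro integral_mono_AE integrable_measure_pmf_finite) (auto simp: AE_measure_pmf_iff)

lemma binomial_pmf_add:
  assumes "p \<in> {0..1}"
  shows "binomial_pmf (a + b) p =
         bind_pmf (binomial_pmf a p) (\<lambda>i. map_pmf (\<lambda>j. i + j) (binomial_pmf b p))"
proof (induction a)
  case 0
  show ?case using assms by (simp add: binomial_pmf_0 bind_return_pmf map_pmf_def bind_return_pmf')
next
  case (Suc a)
  then show ?case using assms
    by (simp add: binomial_pmf_Suc map_pmf_def bind_assoc_pmf bind_return_pmf add.assoc)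
qed

lemma finite_set_depletion:
  assumes "\<And>m. prob D A (snd s) m \<in> {0..1}"
  shows "finite (set_pmf (depletion D s A))"
  unfolding depletion_def set_Pi_pmf[OF finite]
  using assms by (intro finite_PiE_dflt) auto

lemma depletion_le:
  assumes "\<And>m. prob D A (snd s) m \<in> {0..1}" "X \<in> set_pmf (depletion D s A)"
  shows "X m \<le> fst s m"
proof -
  have "X m \<in> set_pmf (binomial_pmf (fst s m) (prob D A (snd s) m))"
    using assms(2) by (auto simp: depletion_def set_Pi_pmf PiE_dflt_def)
  with assms(1)[of m] show ?thesis
    by (auto simp: set_pmf_binomial_eq split: if_splits)
qed

lemma depletion_add:
  fixes D :: "('m::finite, 'a) sdp"
  assumes "\<And>m. prob D A t m \<in> {0..1}"
  shows "depletion D (\<lambda>m. x m + d m, t) A =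
         bind_pmf (depletion D (x, t) A)
           (\<lambda>X. map_pmf (\<lambda>Y m. X m + Y m) (depletion D (d, t) A))"
proof -
  let ?b = "\<lambda>x m. binomial_pmf (x m :: nat) (prob D A t m)"
  have "Pi_pmf UNIV 0 (\<lambda>m. map_pmf (\<lambda>j. X m + j) (?b d m)) =
        map_pmf (\<lambda>Y m. X m + Y m) (Pi_pmf UNIV 0 (?b d))" for X :: "'m \<Rightarrow> nat"
    unfolding map_pmf_def by (subst Pi_pmf_bind[where d' = 0]) simp_all
  then show ?thesis
    unfolding depletion_def using assms
    by (simp add: binomial_pmf_add Pi_pmf_bind[where d' = 0])
qed

section \<open>The Bellman recursion\<close>

text \<open>
  The optimal expected reward over the next \<open>n\<close> steps from \<open>s\<close>. The recursion is on the number of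
  remaining steps, so in a state \<open>s\<close> of the problem the relevant index is \<open>horizon D - snd s\<close>.
\<close>
primrec bellman_value :: "('m::finite, 'a) sdp \<Rightarrow> nat \<Rightarrow> 'm state \<Rightarrow> real" where
  "bellman_value D 0 s = 0"
| "bellman_value D (Suc n) s =
     Max ((\<lambda>A. measure_pmf.expectation (depletion D s A)
                 (\<lambda>X. reward D s X + bellman_value D n (next_state s X))) ` activities D)"

theorem bellman_value_mono:
  fixes D :: "('m::finite, 'a) sdp"
  assumes D: "linear_decaying_sdp D" and "t + n \<le> horizon D" and "\<And>m. x m \<le> y m"
  shows "bellman_value D n (x, t) \<le> bellman_value D n (y, t)"
  using assms(2,3)
proof (induction n arbitrary: t x y)
  case 0
  show ?case by simp
next
  case (Suc n)
  define Q where "Q = (\<lambda>x A. measure_pmf.expectation (depletion D (x, t) A)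
    (\<lambda>X. reward D (x, t) X + bellman_value D n (next_state (x, t) X)))"
  define d where "d = (\<lambda>m. y m - x m)"
  have y: "y = (\<lambda>m. x m + d m)"
    using Suc.prems(2) by (auto simp: d_def)
  have fin: "finite (activities D)" and ne: "activities D \<noteq> {}"
    using D by (auto simp: linear_decaying_sdp_def)
  have w: "weight D m t \<ge> 0" for m
    using D Suc.prems(1) by (auto simp: linear_decaying_sdp_def)
  have Q_mono: "Q x A \<le> Q y A" if A: "A \<in> activities D" for A
  proof -
    have p: "prob D A t m \<in> {0..1}" for m
      using D A by (auto simp: linear_decaying_sdp_def)
    have fin_depl: "finite (set_pmf (depletion D (z, t) A))" for z
      using p by (intro finite_set_depletion) auto
    let ?g = "\<lambda>X. reward D (y, t) X + bellman_value D n (next_state (y, t) X)"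
    let ?h = "\<lambda>X. reward D (x, t) X + bellman_value D n (next_state (x, t) X)"
    have pointwise: "?h X \<le> ?g (\<lambda>m. X m + Y m)"
      if Y: "Y \<in> set_pmf (depletion D (d, t) A)" for X Y
    proof -
      have Y_le: "Y m \<le> d m" for m
        using depletion_le[OF _ Y, of m] p by auto
      have "reward D (x, t) X \<le> reward D (y, t) (\<lambda>m. X m + Y m)"
        using w by (auto simp: reward_def intro!: sum_mono mult_left_mono)
      moreover have "bellman_value D n (next_state (x, t) X)
          \<le> bellman_value D n (next_state (y, t) (\<lambda>m. X m + Y m))"
        unfolding next_state_def fst_conv snd_conv
      proof (rule Suc.IH)
        show "Suc t + n \<le> horizon D" using Suc.prems(1) by simp
        show "x m - X m \<le> y m - (X m + Y m)" for m
          using Y_le[of m] by (simp add: y)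
      qed
      ultimately show ?thesis by simp
    qed
    have "Q x A \<le> measure_pmf.expectation (depletion D (x, t) A)
        (\<lambda>X. measure_pmf.expectation (depletion D (d, t) A) (\<lambda>Y. ?g (\<lambda>m. X m + Y m)))"
      unfolding Q_def
    proof (rule expectation_mono_finite[OF fin_depl])
      fix X
      have "?h X = measure_pmf.expectation (depletion D (d, t) A) (\<lambda>_. ?h X)"
        by simp
      also have "\<dots> \<le> measure_pmf.expectation (depletion D (d, t) A) (\<lambda>Y. ?g (\<lambda>m. X m + Y m))"
        by (rule expectation_mono_finite[OF fin_depl pointwise])
      finally show "?h X \<le> \<dots>" .
    qed
    also have "\<dots> = measure_pmf.expectation (depletion D (\<lambda>m. x m + d m, t) A) ?g"
      using p fin_depl by (subst depletion_add) (simp_all add: expectation_bind_pmf_finite)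
    also have "\<dots> = Q y A"
      unfolding Q_def y ..
    finally show ?thesis .
  qed
  have "Max (Q x ` activities D) \<le> Max (Q y ` activities D)"
  proof (rule Max.boundedI)
    fix v assume "v \<in> Q x ` activities D"
    then obtain A where A: "A \<in> activities D" "v = Q x A" by auto
    note A(2)
    also have "Q x A \<le> Q y A" using A(1) by (rule Q_mono)
    also have "\<dots> \<le> Max (Q y ` activities D)" using A(1) fin by simp
    finally show "v \<le> Max (Q y ` activities D)" .
  qed (use fin ne in auto)
  then show ?case by (simp add: Q_def)
qed

section \<open>Value of a policy\<close>

text \<open>
  The expected reward of \<open>\<pi>\<close> over the next \<open>n\<close> steps from \<open>s\<close>; unlike \<open>J\<close>, it is indexed by
  the number of remaining steps.
\<close>
definition policy_value ::
    "('m::finite, 'a) sdp \<Rightarrow> ('m state \<Rightarrow> 'a) \<Rightarrow> nat \<Rightarrow> 'm state \<Rightarrow> real" where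
  "policy_value D \<pi> n s = measure_pmf.expectation (trajectory D \<pi> n s)
     (\<lambda>\<omega>. \<Sum>i<n. case \<omega> ! i of (s', X) \<Rightarrow> reward D s' X)"

lemma J_eq_policy_value: "J D \<pi> s = policy_value D \<pi> (horizon D - snd s) s"
proof -
  have "(\<Sum>t\<in>{snd s..<horizon D}. case \<omega> ! (t - snd s) of (s', X) \<Rightarrow> reward D s' X) =
        (\<Sum>i<horizon D - snd s. case \<omega> ! i of (s', X) \<Rightarrow> reward D s' X)" for \<omega>
    by (rule sum.reindex_bij_witness[of _ "\<lambda>i. i + snd s" "\<lambda>t. t - snd s"]) auto
  then show ?thesis
    unfolding J_def policy_value_def by simp
qed

lemma next_state_in_states:
  assumes "s \<in> states D" "snd s < horizon D"
  shows "next_state s X \<in> states D"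
  using assms by (auto simp: states_def next_state_def intro: le_trans[OF diff_le_self])

lemma prob_policy:
  assumes "linear_decaying_sdp D" "\<pi> \<in> policies D" "s \<in> states D"
  shows "prob D (\<pi> s) t m \<in> {0..1}"
  using assms by (auto simp: linear_decaying_sdp_def policies_def PiE_iff)

lemma finite_set_trajectory:
  assumes "linear_decaying_sdp D" "\<pi> \<in> policies D" "s \<in> states D" "snd s + n \<le> horizon D"
  shows "finite (set_pmf (trajectory D \<pi> n s))"
  using assms(3,4)
proof (induction n arbitrary: s)
  case (Suc n)
  have "finite (set_pmf (trajectory D \<pi> n (next_state s X)))" for X
    using Suc.prems by (intro Suc.IH next_state_in_states) (auto simp: next_state_def)
  moreover have "finite (set_pmf (depletion D s (\<pi> s)))"
    by (rule finite_set_depletion) (rule prob_policy[OF assms(1,2) Suc.prems(1)])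
  ultimately show ?case by simp
qed simp

lemma policy_value_Suc:
  assumes D: "linear_decaying_sdp D" and pi: "\<pi> \<in> policies D"
    and s: "s \<in> states D" "snd s + Suc n \<le> horizon D"
  shows "policy_value D \<pi> (Suc n) s = measure_pmf.expectation (depletion D s (\<pi> s))
           (\<lambda>X. reward D s X + policy_value D \<pi> n (next_state s X))"
proof -
  have fin: "finite (set_pmf (trajectory D \<pi> n (next_state s X)))" for X
    using s by (intro finite_set_trajectory[OF D pi] next_state_in_states) (auto simp: next_state_def)
  have fin_depl: "finite (set_pmf (depletion D s (\<pi> s)))"
    by (rule finite_set_depletion) (rule prob_policy[OF D pi s(1)])
  have "measure_pmf.expectation (trajectory D \<pi> n (next_state s X))
          (\<lambda>\<omega>. reward D s X + (\<Sum>i<n. case \<omega> ! i of (s', X) \<Rightarrow> reward D s' X)) =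
        reward D s X + policy_value D \<pi> n (next_state s X)" for X
    unfolding policy_value_def
    by (subst Bochner_Integration.integral_add) (auto intro: integrable_measure_pmf_finite fin)
  then show ?thesis
    unfolding policy_value_def[of _ _ "Suc n"] using fin fin_depl
    by (simp add: expectation_bind_pmf_finite sum.lessThan_Suc_shift del: sum.lessThan_Suc)
qed

section \<open>Optimality\<close>

lemma policy_value_le_bellman_value:
  assumes D: "linear_decaying_sdp D" and pi: "\<pi> \<in> policies D"
    and "s \<in> states D" "snd s + n \<le> horizon D"
  shows "policy_value D \<pi> n s \<le> bellman_value D n s"
  using assms(3,4)
proof (induction n arbitrary: s)
  case 0
  show ?case by (simp add: policy_value_def)
next
  case (Suc n)
  have act: "\<pi> s \<in> activities D"
    using pi Suc.prems(1) by (auto simp: policies_def)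
  have "policy_value D \<pi> (Suc n) s = measure_pmf.expectation (depletion D s (\<pi> s))
           (\<lambda>X. reward D s X + policy_value D \<pi> n (next_state s X))"
    by (rule policy_value_Suc[OF D pi Suc.prems])
  also have "\<dots> \<le> measure_pmf.expectation (depletion D s (\<pi> s))
           (\<lambda>X. reward D s X + bellman_value D n (next_state s X))"
  proof (rule expectation_mono_finite)
    show "finite (set_pmf (depletion D s (\<pi> s)))"
      by (rule finite_set_depletion) (rule prob_policy[OF D pi Suc.prems(1)])
    show "reward D s X + policy_value D \<pi> n (next_state s X)
        \<le> reward D s X + bellman_value D n (next_state s X)" for X
      using Suc.prems by (intro add_left_mono Suc.IH next_state_in_states) (auto simp: next_state_def)
  qed
  also have "\<dots> \<le> bellman_value D (Suc n) s"
    using D act by (auto simp: linear_decaying_sdp_def intro!: Max_ge)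
  finally show ?case .
qed

lemma ex_policy_attaining_bellman_value:
  assumes D: "linear_decaying_sdp D"
  obtains \<pi> where "\<pi> \<in> policies D"
    and "\<And>s. s \<in> states D \<Longrightarrow> policy_value D \<pi> (horizon D - snd s) s = bellman_value D (horizon D - snd s) s"
proof -
  define Q where "Q = (\<lambda>n s A. measure_pmf.expectation (depletion D s A)
    (\<lambda>X. reward D s X + bellman_value D n (next_state s X)))"
  have "\<exists>A\<in>activities D. Q n s A = bellman_value D (Suc n) s" for n s
  proof -
    have "Max (Q n s ` activities D) \<in> Q n s ` activities D"
      using D by (intro Max_in) (auto simp: linear_decaying_sdp_def)
    then show ?thesis by (auto simp: Q_def)
  qed
  then obtain a where a: "\<And>n s. a n s \<in> activities D" "\<And>n s. Q n s (a n s) = bellman_value D (Suc n) s"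
    by metis
  \<comment> \<open>At time \<open>t\<close> one step is taken and \<open>horizon D - Suc t\<close> steps remain after it.\<close>
  define \<pi> where "\<pi> = restrict (\<lambda>s. a (horizon D - Suc (snd s)) s) (states D)"
  have pi: "\<pi> \<in> policies D"
    using a(1) by (auto simp: \<pi>_def policies_def)
  have "policy_value D \<pi> n s = bellman_value D n s" if "s \<in> states D" "snd s + n = horizon D" for n s
    using that
  proof (induction n arbitrary: s)
    case 0
    show ?case by (simp add: policy_value_def)
  next
    case (Suc n)
    have "policy_value D \<pi> n (next_state s X) = bellman_value D n (next_state s X)" for X
      using Suc.prems by (intro Suc.IH next_state_in_states) (auto simp: next_state_def)
    moreover have "horizon D - Suc (snd s) = n"
      using Suc.prems(2) by simp
    then have "\<pi> s = a n s"
      using Suc.prems(1) by (simp add: \<pi>_def)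
    ultimately show ?case
      using policy_value_Suc[OF D pi Suc.prems(1), of n] Suc.prems(2) a(2)[of n s]
      by (simp add: Q_def)
  qed
  with pi show ?thesis
    by (intro that) (auto simp: states_def)
qed

theorem J_opt_eq_bellman_value:
  assumes D: "linear_decaying_sdp D" and s: "s \<in> states D"
  shows "J_opt D s = bellman_value D (horizon D - snd s) s"
proof (rule antisym)
  obtain \<pi> where "\<pi> \<in> policies D" "J_opt D s = J D \<pi> s"
    using J_opt_attained[OF D] .
  then show "J_opt D s \<le> bellman_value D (horizon D - snd s) s"
    using policy_value_le_bellman_value[OF D _ s] s by (auto simp: J_eq_policy_value states_def)
next
  obtain \<pi> where pi: "\<pi> \<in> policies D" "J D \<pi> s = bellman_value D (horizon D - snd s) s"
    using ex_policy_attaining_bellman_value[OF D] s by (metis J_eq_policy_value)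
  have "J D \<pi> s \<le> J_opt D s"
    unfolding J_opt_def using finite_policies[OF D] pi(1) by simp
  with pi(2) show "bellman_value D (horizon D - snd s) s \<le> J_opt D s" by simp
qed

section \<open>Monotonicity of the optimal value\<close>

theorem lemma4:
  fixes D :: "('m::finite, 'a) sdp"
    and s s' :: "'m state"
  assumes "linear_decaying_sdp D"
    and "s \<in> states D"
    and "s' \<in> states D"
    and "\<forall>m. fst s m \<ge> fst s' m"
    and "snd s = snd s'"
  shows "J_opt D s \<ge> J_opt D s'"
proof -
  have "snd s + (horizon D - snd s) \<le> horizon D"
    using assms(2) by (auto simp: states_def)
  then have "bellman_value D (horizon D - snd s) (fst s', snd s)
      \<le> bellman_value D (horizon D - snd s) (fst s, snd s)"
    using assms(4) by (intro bellman_value_mono[OF assms(1)]) auto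
  then have "bellman_value D (horizon D - snd s') s' \<le> bellman_value D (horizon D - snd s) s"
    by (metis assms(5) prod.collapse)
  then show ?thesis
    using assms(1-3) by (simp only: J_opt_eq_bellman_value)
qed

end
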